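(* Let $\Bbbk$ be an algebraically closed field of characteristic zero, let $q\in\Bbbk^{*}$ and let $f\in\Bbbk[t]$. Let $B_q(f)$ be the associative unital $\Bbbk$-algebra generated by $u,v,w$ subject to the relations $uv=qvu$, $wu=quw+f(v)$, $wv=q^{-1}vw+f(u)$. Then the set $$\mathcal{B}:=\{\,v^{i}u^{j}w^{k}\mid i,j,k\in\mathbb{N}\,\}$$ is a $\Bbbk$-basis for $B_q(f)$.
   Context: Here $\mathbb{N}$ includes $0$. $B_q(f)$ is the quotient of the free algebra $\Bbbk\langle u,v,w\rangle$ by the two-sided ideal generated by the three displayed relations. *)

theory Defs
  imports
    "HOL-Library.Poly_Mapping"
    "HOL-Computational_Algebra.Polynomial"
    "HOL-Algebra.Algebraic_Closure_Type"
    "HOL-Algebra.QuotRing"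
    "Jordan_Normal_Form.Missing_VectorSpace"
begin

datatype generator = U | V | W

text \<open>
  Words are a copy of \<^typ>\<open>generator list\<close> with concatenation written additively, so that the
  convolution product of \<^theory>\<open>HOL-Library.Poly_Mapping\<close> makes finitely supported functions
  on words into the free algebra.
\<close>

datatype word = Word (letters: "generator list")

instantiation word :: monoid_add
begin

definition zero_word :: word where
  "0 = Word []"

definition plus_word :: "word \<Rightarrow> word \<Rightarrow> word" where
  "x + y = Word (letters x @ letters y)"

instance
  by standard (simp_all add: zero_word_def plus_word_def)

end

type_synonym 'k free_alg = "word \<Rightarrow>\<^sub>0 'k"

definition scalar :: "'k \<Rightarrow> 'k::field free_alg" where
  "scalar c = Poly_Mapping.single 0 c"

definition free_gen :: "generator \<Rightarrow> 'k::field free_alg" where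
  "free_gen x = Poly_Mapping.single (Word [x]) 1"

text \<open>The constant \<^const>\<open>poly\<close> only evaluates in the commutative coefficient ring.\<close>

definition poly_eval :: "'k::field poly \<Rightarrow> 'k free_alg \<Rightarrow> 'k free_alg" where
  "poly_eval f x = (\<Sum>i\<le>degree f. scalar (coeff f i) * x ^ i)"

definition Bq_relations :: "'k::field \<Rightarrow> 'k poly \<Rightarrow> 'k free_alg set" where
  "Bq_relations q f =
    (let u = free_gen U; v = free_gen V; w = free_gen W in
      {u * v - scalar q * v * u,
       w * u - (scalar q * u * w + poly_eval f v),
       w * v - (scalar (inverse q) * v * w + poly_eval f u)})"

text \<open>For noncommutative rings, \<^const>\<open>ideal\<close> and \<^const>\<open>genideal\<close> are two-sided.\<close>

definition Bq_ideal :: "'k::field \<Rightarrow> 'k poly \<Rightarrow> 'k free_alg set" where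
  "Bq_ideal q f = genideal ring_of_type_algebra (Bq_relations q f)"

definition Bq_class :: "'k::field \<Rightarrow> 'k poly \<Rightarrow> 'k free_alg \<Rightarrow> 'k free_alg set" where
  "Bq_class q f x = Bq_ideal q f +>\<^bsub>ring_of_type_algebra\<^esub> x"

text \<open>
  The quotient ring, with the scalar action given by multiplication with the images of the scalars.
\<close>

definition Bq :: "'k::field \<Rightarrow> 'k poly \<Rightarrow> ('k, 'k free_alg set) module" where
  "Bq q f =
    (let Q = ring_of_type_algebra Quot Bq_ideal q f in
      ring.extend Q (module.fields (\<lambda>c x. Bq_class q f (scalar c) \<otimes>\<^bsub>Q\<^esub> x)))"

definition Bq_gen :: "'k::field \<Rightarrow> 'k poly \<Rightarrow> generator \<Rightarrow> 'k free_alg set" where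
  "Bq_gen q f x = Bq_class q f (free_gen x)"

definition Bq_monomial :: "'k::field \<Rightarrow> 'k poly \<Rightarrow> nat \<times> nat \<times> nat \<Rightarrow> 'k free_alg set" where
  "Bq_monomial q f = (\<lambda>(i, j, k).
    Bq_gen q f V [^]\<^bsub>Bq q f\<^esub> i \<otimes>\<^bsub>Bq q f\<^esub> Bq_gen q f U [^]\<^bsub>Bq q f\<^esub> j
      \<otimes>\<^bsub>Bq q f\<^esub> Bq_gen q f W [^]\<^bsub>Bq q f\<^esub> k)"

text \<open>
  The constant \<^const>\<open>vectorspace.basis\<close> is only specified for vector spaces, so the following
  lemma is what gives it its meaning for \<^const>\<open>Bq\<close>.
\<close>

lemma ring_of_type_algebra_ring: "ring (ring_of_type_algebra :: 'a::ring_1 ring)"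
proof -
  have "\<exists>y. x + y = 0" for x :: 'a
    using add.right_inverse by blast
  then show ?thesis
    unfolding ring_of_type_algebra_def using add.right_inverse
    by unfold_locales (auto simp: algebra_simps Units_def)
qed

lemma Bq_ideal_ideal: "ideal (Bq_ideal q f) ring_of_type_algebra"
  unfolding Bq_ideal_def
  by (intro ring.genideal_ideal ring_of_type_algebra_ring) (simp add: ring_of_type_algebra_def)

lemma Bq_class_hom: "Bq_class q f \<in> ring_hom ring_of_type_algebra (ring_of_type_algebra Quot Bq_ideal q f)"
  unfolding Bq_class_def by (rule ideal.rcos_ring_hom[OF Bq_ideal_ideal])

lemma Bq_vectorspace:
  fixes q :: "'k::field"
  shows "vectorspace ring_of_type_algebra (Bq q f)"
proof -
  let ?K = "ring_of_type_algebra :: 'k ring"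
  let ?F = "ring_of_type_algebra :: 'k free_alg ring"
  let ?Q = "?F Quot Bq_ideal q f"
  interpret Q: ring ?Q
    by (rule ideal.quotient_is_ring[OF Bq_ideal_ideal])
  interpret K: field ?K
    by (rule field_from_type_algebra)
  have sel: "carrier (Bq q f) = carrier ?Q" "add (Bq q f) = add ?Q" "zero (Bq q f) = zero ?Q"
    "monoid.mult (Bq q f) = monoid.mult ?Q" "one (Bq q f) = one ?Q"
    "module.smult (Bq q f) = (\<lambda>c x. Bq_class q f (scalar c) \<otimes>\<^bsub>?Q\<^esub> x)"
    by (simp_all add: Bq_def Let_def ring.extend_def module.fields_def)
  have cl: "Bq_class q f x \<in> carrier ?Q" for x
    using ring_hom_closed[OF Bq_class_hom] by (simp add: ring_of_type_algebra_def)
  have mul: "Bq_class q f (x * y) = Bq_class q f x \<otimes>\<^bsub>?Q\<^esub> Bq_class q f y" for x y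
    using ring_hom_mult[OF Bq_class_hom] by (simp add: ring_of_type_algebra_def)
  have pl: "Bq_class q f (x + y) = Bq_class q f x \<oplus>\<^bsub>?Q\<^esub> Bq_class q f y" for x y
    using ring_hom_add[OF Bq_class_hom] by (simp add: ring_of_type_algebra_def)
  have one: "Bq_class q f 1 = \<one>\<^bsub>?Q\<^esub>"
    using ring_hom_one[OF Bq_class_hom] by (simp add: ring_of_type_algebra_def)
  have neg: "\<exists>y\<in>carrier ?Q. y \<oplus>\<^bsub>?Q\<^esub> x = \<zero>\<^bsub>?Q\<^esub>" if "x \<in> carrier ?Q" for x
    using Q.l_neg[OF that] Q.a_inv_closed[OF that] by blast
  have grp: "abelian_group (Bq q f)"
    by (rule abelian_groupI) (simp_all add: sel neg Q.a_ac)
  have K: "add ?K = (+)" "monoid.mult ?K = (*)" "one ?K = 1"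
    by (simp_all add: ring_of_type_algebra_def)
  have sc: "scalar (a + b) = scalar a + scalar b" "scalar (a * b) = scalar a * scalar b"
    "scalar 1 = 1" for a b :: 'k
    by (simp_all add: scalar_def single_add mult_single)
  have "module ?K (Bq q f)"
    by (rule moduleI[OF K.is_cring grp])
      (simp_all add: sel K cl sc mul pl one Q.l_distr Q.r_distr Q.m_assoc)
  then show ?thesis
    unfolding vectorspace_def using K.field_axioms by blast
qed

end

theory Submission
  imports Defs
begin

text \<open>
  The relations rewrite every word into normal monomials \<open>v\<^sup>i u\<^sup>j w\<^sup>k\<close>, by moving \<open>v\<close> to the left and
  \<open>w\<close> to the right. The only word in which two rewritings compete is \<open>w u v\<close>, and both of them end in
  \<open>q v u w + v f(v) + q u f(u)\<close>; this is why no monomial becomes redundant. Instead of a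
  rewriting argument, the proof turns the rewriting into a representation.

  Let \<open>M\<close> be the vector space with basis vectors \<open>e\<^bsub>ijk\<^esub>\<close>. The operators by which \<open>u\<close>, \<open>v\<close> and \<open>w\<close>
  would act on \<open>e\<^bsub>ijk\<^esub> = v\<^sup>i u\<^sup>j w\<^sup>k\<close> are written down, the one for \<open>w\<close> by recursion on \<open>i\<close> and
  \<open>j\<close> (\<open>W_monomial\<close>). The relations for \<open>u v\<close> and \<open>w v\<close> then hold immediately. The relation for
  \<open>w u\<close> is built in only for \<open>i = 0\<close>, and the induction step from \<open>i\<close> to \<open>i + 1\<close> is exactly the
  comparison of the two rewritings of \<open>w u v\<close> (\<open>W_U_op\<close>). Hence the free algebra acts on \<open>M\<close> with
  the defining ideal acting as zero (\<open>act_ideal\<close>), and \<open>a \<mapsto> a \<cdot> e\<^bsub>000\<^esub>\<close> is a well defined linear map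
  \<open>normal_form\<close> from the quotient to \<open>M\<close>.

  In the other direction, \<open>realize\<close> sends \<open>e\<^bsub>ijk\<^esub>\<close> to \<open>v\<^sup>i u\<^sup>j w\<^sup>k\<close>. The same recursion, read in the
  quotient, shows that it intertwines the operators with left multiplication by the generators
  (\<open>realizes_gen\<close>). Therefore \<open>realize (normal_form a)\<close> is congruent to \<open>a\<close>, so the monomials span
  (\<open>Bq_class_realize_normal_form\<close>), and \<open>normal_form\<close> inverts \<open>realize\<close>, so they are independent
  (\<open>normal_form_realize\<close>).
\<close>

section \<open>Linear maps between spaces of finitely supported functions\<close>

text \<open>
  The index set carries no addition in general, so multiplication by a constant
  cannot be expressed by the convolution product.
\<close>

definition smul :: "'k::field \<Rightarrow> ('a \<Rightarrow>\<^sub>0 'k) \<Rightarrow> ('a \<Rightarrow>\<^sub>0 'k)" where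
  "smul c p = Poly_Mapping.map ((*) c) p"

lemma lookup_smul [simp]: "Poly_Mapping.lookup (smul c p) x = c * Poly_Mapping.lookup p x"
  by (simp add: smul_def Poly_Mapping.map.rep_eq when_def)

lemma smul_single [simp]: "smul c (Poly_Mapping.single x d) = Poly_Mapping.single x (c * d)"
  by (rule poly_mapping_eqI) (simp add: lookup_single when_def)

interpretation smul: vector_space smul
  by unfold_locales (auto intro!: poly_mapping_eqI simp: lookup_add algebra_simps)

abbreviation linear_map :: "(('a \<Rightarrow>\<^sub>0 'k::field) \<Rightarrow> ('b \<Rightarrow>\<^sub>0 'k)) \<Rightarrow> bool" where
  "linear_map \<equiv> Vector_Spaces.linear smul smul"

interpretation smul_pair: vector_space_pair smul smul
  by unfold_locales

lemma linear_mapI: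
  assumes "\<And>a b. F (a + b) = F a + F b" "\<And>c a. F (smul c a) = smul c (F a)"
  shows "linear_map F"
  by (simp add: Vector_Spaces.linear_iff assms smul.vector_space_axioms)

lemmas linear_map_simps =
  smul_pair.linear_add smul_pair.linear_scale smul_pair.linear_0 smul_pair.linear_diff
  smul_pair.linear_sum

lemma linear_map_comp: "linear_map F \<Longrightarrow> linear_map G \<Longrightarrow> linear_map (\<lambda>x. F (G x))"
  using Vector_Spaces.linear_compose[of smul smul G smul F] by (simp add: o_def)

lemma linear_map_ident: "linear_map (\<lambda>x. x)"
  by (rule linear_mapI) simp_all

text \<open>
  Without the type constraint, \<open>^^\<close> could stand for another instance of iteration and source and
  target would be unrelated.
\<close>

lemma linear_map_funpow:
  fixes F :: "('a \<Rightarrow>\<^sub>0 'k::field) \<Rightarrow> ('a \<Rightarrow>\<^sub>0 'k)"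
  assumes "linear_map F"
  shows "linear_map (F ^^ n)"
proof (induction n)
  case 0
  show ?case
    using linear_map_ident by (simp add: id_def)
next
  case (Suc n)
  with assms show ?case
    using linear_map_comp[of F "F ^^ n"] by (simp add: o_def)
qed

lemma decompose_finsupp:
  "p = (\<Sum>x\<in>Poly_Mapping.keys p. smul (Poly_Mapping.lookup p x) (Poly_Mapping.single x 1))"
  by (rule poly_mapping_eqI)
    (simp add: lookup_sum lookup_single when_def sum.delta' in_keys_iff)

lemma finsupp_induct:
  assumes "P 0" "\<And>a b. P a \<Longrightarrow> P b \<Longrightarrow> P (a + b)"
    "\<And>c x. P (smul c (Poly_Mapping.single x 1))"
  shows "P p"
proof -
  have "P (\<Sum>x\<in>S. smul (Poly_Mapping.lookup p x) (Poly_Mapping.single x 1))" if "finite S" for S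
    using that by induction (use assms in auto)
  then show ?thesis
    by (subst decompose_finsupp) simp
qed

definition lin_ext :: "('a \<Rightarrow> ('b \<Rightarrow>\<^sub>0 'k)) \<Rightarrow> ('a \<Rightarrow>\<^sub>0 'k::field) \<Rightarrow> ('b \<Rightarrow>\<^sub>0 'k)" where
  "lin_ext g p = (\<Sum>x\<in>Poly_Mapping.keys p. smul (Poly_Mapping.lookup p x) (g x))"

lemma lin_ext_superset:
  assumes "finite S" "Poly_Mapping.keys p \<subseteq> S"
  shows "lin_ext g p = (\<Sum>x\<in>S. smul (Poly_Mapping.lookup p x) (g x))"
  unfolding lin_ext_def using assms
  by (intro sum.mono_neutral_left) (auto simp: in_keys_iff)

lemma linear_lin_ext: "linear_map (lin_ext g)"
proof (rule linear_mapI)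
  show "lin_ext g (a + b) = lin_ext g a + lin_ext g b" for a b
    using keys_add[of a b]
    by (simp add: lin_ext_superset[of "Poly_Mapping.keys a \<union> Poly_Mapping.keys b"] lookup_add
        smul.scale_left_distrib sum.distrib)
  show "lin_ext g (smul c a) = smul c (lin_ext g a)" for c a
  proof -
    have "Poly_Mapping.keys (smul c a) \<subseteq> Poly_Mapping.keys a"
      by (auto simp: in_keys_iff)
    then show ?thesis
      by (simp add: lin_ext_superset[of "Poly_Mapping.keys a"] smul.scale_sum_right)
  qed
qed

lemma lin_ext_single [simp]: "lin_ext g (Poly_Mapping.single x c) = smul c (g x)"
  by (simp add: lin_ext_superset[of "{x}"])

lemma linear_map_eqI:
  assumes "linear_map F" "linear_map G"
    "\<And>x. F (Poly_Mapping.single x 1) = G (Poly_Mapping.single x 1)"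
  shows "F p = G p"
  by (rule finsupp_induct) (simp_all add: linear_map_simps assms del: smul_single)

lemma linear_map_add: "linear_map F \<Longrightarrow> linear_map G \<Longrightarrow> linear_map (\<lambda>x. F x + G x)"
  by (rule smul_pair.linear_compose_add)

lemma linear_map_smul: "linear_map F \<Longrightarrow> linear_map (\<lambda>x. smul c (F x))"
  by (rule smul_pair.linear_compose_scale_right)

lemma linear_map_sum:
  assumes "\<And>i. i \<in> I \<Longrightarrow> linear_map (F i)"
  shows "linear_map (\<lambda>x. \<Sum>i\<in>I. F i x)"
  by (rule linear_mapI) (simp_all add: linear_map_simps assms sum.distrib smul.scale_sum_right)

section \<open>Modules over the free algebra\<close>

lemma smul_eq_scalar_mult: "smul c a = scalar c * a"
  by (induction a rule: finsupp_induct)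
    (simp_all add: scalar_def mult_single smul.scale_right_distrib distrib_left)

text \<open>
  Scalars live on the empty word, which is neutral for concatenation on both sides.
\<close>

lemma scalar_central: "a * scalar c = scalar c * a"
  by (induction a rule: finsupp_induct)
    (simp_all add: scalar_def mult_single distrib_left distrib_right mult.commute)

lemma mult_smul_left [simp]: "smul c a * b = smul c (a * b)" for a b :: "'k::field free_alg"
  by (simp add: smul_eq_scalar_mult mult.assoc)

lemma mult_smul_right [simp]: "a * smul c b = smul c (a * b)" for a b :: "'k::field free_alg"
  by (metis smul_eq_scalar_mult scalar_central mult.assoc)

lemma linear_mult_left: "linear_map (\<lambda>b :: 'k::field free_alg. a * b)"
  by (rule linear_mapI) (simp_all add: distrib_left)

lemma linear_mult_right: "linear_map (\<lambda>a :: 'k::field free_alg. a * b)"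
  by (rule linear_mapI) (simp_all add: distrib_right)

text \<open>
  The operator \<open>f(T)\<close>, the counterpart of \<^const>\<open>poly_eval\<close> for an endomorphism \<open>T\<close>.
\<close>

definition poly_op ::
    "'k::field poly \<Rightarrow> (('a \<Rightarrow>\<^sub>0 'k) \<Rightarrow> ('a \<Rightarrow>\<^sub>0 'k)) \<Rightarrow> ('a \<Rightarrow>\<^sub>0 'k) \<Rightarrow> ('a \<Rightarrow>\<^sub>0 'k)" where
  "poly_op f T m = (\<Sum>i\<le>degree f. smul (coeff f i) ((T ^^ i) m))"

lemma linear_poly_op: "linear_map T \<Longrightarrow> linear_map (poly_op f T)"
  unfolding poly_op_def
  by (intro linear_map_sum linear_map_smul linear_map_funpow)

lemma poly_op_commute:
  assumes "linear_map T"
  shows "poly_op f T (T m) = T (poly_op f T m)"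
  by (simp only: poly_op_def linear_map_simps[OF assms] funpow_swap1)

text \<open>
  A family of operators \<open>T\<close>, one for each generator, makes a vector space into a left module over
  the free algebra; the last letter of a word acts first.
\<close>

definition act ::
    "(generator \<Rightarrow> ('a \<Rightarrow>\<^sub>0 'k) \<Rightarrow> ('a \<Rightarrow>\<^sub>0 'k)) \<Rightarrow> 'k::field free_alg \<Rightarrow> ('a \<Rightarrow>\<^sub>0 'k) \<Rightarrow> ('a \<Rightarrow>\<^sub>0 'k)" where
  "act T a m = lin_ext (\<lambda>x. foldr T (letters x) m) a"

lemma linear_act_left: "linear_map (\<lambda>a. act T a m)"
  unfolding act_def by (rule linear_lin_ext)

lemma linear_foldr:
  assumes "\<And>x. linear_map (T x)"
  shows "linear_map (foldr T xs)"
  by (induction xs) (auto intro: linear_map_comp linear_map_ident assms simp: o_def id_def)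

lemma linear_act_right:
  assumes "\<And>x. linear_map (T x)"
  shows "linear_map (act T a)"
  unfolding act_def lin_ext_def
  by (intro linear_map_sum linear_map_smul linear_foldr assms)

text \<open>
  Both sides are bilinear in \<open>a\<close> and \<open>b\<close>, so it is enough to compare them on words, where the claim is
  that acting by a concatenation is acting twice.
\<close>

lemma act_mult:
  assumes "\<And>x. linear_map (T x)"
  shows "act T (a * b) m = act T a (act T b m)"
proof (rule linear_map_eqI[of "\<lambda>a. act T (a * b) m" "\<lambda>a. act T a (act T b m)"])
  show "linear_map (\<lambda>a. act T (a * b) m)"
    by (rule linear_map_comp[OF linear_act_left linear_mult_right])
  show "linear_map (\<lambda>a. act T a (act T b m))"
    by (rule linear_act_left)
  fix x
  show "act T (Poly_Mapping.single x 1 * b) m = act T (Poly_Mapping.single x 1) (act T b m)"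
  proof (rule linear_map_eqI[of "\<lambda>b. act T (Poly_Mapping.single x 1 * b) m"
        "\<lambda>b. act T (Poly_Mapping.single x 1) (act T b m)"])
    show "linear_map (\<lambda>b. act T (Poly_Mapping.single x 1 * b) m)"
      by (rule linear_map_comp[OF linear_act_left linear_mult_left])
    show "linear_map (\<lambda>b. act T (Poly_Mapping.single x 1) (act T b m))"
      by (rule linear_map_comp[OF linear_act_right linear_act_left]) (rule assms)
  qed (simp add: act_def mult_single plus_word_def)
qed

lemma act_scalar [simp]: "act T (scalar c) m = smul c m"
  by (simp add: act_def scalar_def zero_word_def)

lemma act_free_gen [simp]: "act T (free_gen x) m = T x m"
  by (simp add: act_def free_gen_def)

lemma act_1 [simp]: "act T 1 m = m"
  using act_scalar[of T 1 m] by (simp add: scalar_def)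

lemma act_power:
  assumes "\<And>x. linear_map (T x)"
  shows "act T (free_gen x ^ n) m = (T x ^^ n) m"
  by (induction n) (simp_all add: act_mult assms)

lemma act_poly_eval:
  assumes "\<And>x. linear_map (T x)"
  shows "act T (poly_eval f (free_gen x)) m = poly_op f (T x) m"
  by (simp add: poly_eval_def poly_op_def smul_pair.linear_sum[OF linear_act_left] act_mult
      act_power assms)

section \<open>The module with basis the normal monomials\<close>

type_synonym 'k normal_module = "(nat \<times> nat \<times> nat) \<Rightarrow>\<^sub>0 'k"

abbreviation monomial_vec :: "nat \<Rightarrow> nat \<Rightarrow> nat \<Rightarrow> 'k::field normal_module" where
  "monomial_vec i j k \<equiv> Poly_Mapping.single (i, j, k) 1"

definition V_op :: "'k::field normal_module \<Rightarrow> 'k normal_module" where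
  "V_op = lin_ext (\<lambda>(i, j, k). monomial_vec (Suc i) j k)"

text \<open>
  The factor \<open>q ^ i\<close> comes from moving \<open>u\<close> past \<open>v\<^sup>i\<close>.
\<close>

definition U_op :: "'k::field \<Rightarrow> 'k normal_module \<Rightarrow> 'k normal_module" where
  "U_op q = lin_ext (\<lambda>(i, j, k). smul (q ^ i) (monomial_vec i (Suc j) k))"

text \<open>
  The value that the relations force on \<open>w v\<^sup>i u\<^sup>j w\<^sup>k\<close>: the leftmost letter is a \<open>v\<close> unless \<open>i = 0\<close>,
  and then a \<open>u\<close> unless \<open>j = 0\<close>; \<open>w\<close> is moved past that letter by the corresponding relation, and the
  remaining monomial is handled recursively.
\<close>

fun W_monomial :: "'k::field \<Rightarrow> 'k poly \<Rightarrow> nat \<Rightarrow> nat \<Rightarrow> nat \<Rightarrow> 'k normal_module" where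
  "W_monomial q f 0 0 k = monomial_vec 0 0 (Suc k)"
| "W_monomial q f 0 (Suc j) k =
    smul q (U_op q (W_monomial q f 0 j k)) + poly_op f V_op (monomial_vec 0 j k)"
| "W_monomial q f (Suc i) j k =
    smul (inverse q) (V_op (W_monomial q f i j k)) + poly_op f (U_op q) (monomial_vec i j k)"

definition W_op :: "'k::field \<Rightarrow> 'k poly \<Rightarrow> 'k normal_module \<Rightarrow> 'k normal_module" where
  "W_op q f = lin_ext (\<lambda>(i, j, k). W_monomial q f i j k)"

fun gen_op :: "'k::field \<Rightarrow> 'k poly \<Rightarrow> generator \<Rightarrow> 'k normal_module \<Rightarrow> 'k normal_module" where
  "gen_op q f U = U_op q"
| "gen_op q f V = V_op"
| "gen_op q f W = W_op q f"

lemma linear_ops: "linear_map (U_op q)" "linear_map V_op" "linear_map (W_op q f)"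
  by (simp_all add: U_op_def V_op_def W_op_def linear_lin_ext)

lemma linear_gen_op: "linear_map (gen_op q f x)"
  by (cases x) (simp_all add: linear_ops)

lemmas gen_op_simps = linear_map_simps[OF linear_gen_op]

lemma ops_monomial_vec:
  "U_op q (monomial_vec i j k) = smul (q ^ i) (monomial_vec i (Suc j) k)"
  "V_op (monomial_vec i j k) = monomial_vec (Suc i) j k"
  "W_op q f (monomial_vec i j k) = W_monomial q f i j k"
  by (simp_all add: U_op_def V_op_def W_op_def)

lemma normal_module_eqI:
  assumes "linear_map F" "linear_map G"
    "\<And>i j k. F (monomial_vec i j k) = G (monomial_vec i j k)"
  shows "F m = G m"
  by (rule linear_map_eqI) (use assms in auto)

lemmas linear_op_simps =
  linear_map_simps[OF linear_ops(1)] linear_map_simps[OF linear_ops(2)]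
  linear_map_simps[OF linear_ops(3)]

lemma U_V_op: "U_op q (V_op m) = smul q (V_op (U_op q m))"
proof (rule normal_module_eqI[of "\<lambda>m. U_op q (V_op m)"])
  show "linear_map (\<lambda>m. U_op q (V_op m))"
    by (rule linear_map_comp[OF linear_ops(1) linear_ops(2)])
  show "linear_map (\<lambda>m. smul q (V_op (U_op q m)))"
    by (rule linear_map_smul[OF linear_map_comp[OF linear_ops(2) linear_ops(1)]])
qed (simp add: ops_monomial_vec linear_op_simps del: smul_single)

lemma W_V_op: "W_op q f (V_op m) = smul (inverse q) (V_op (W_op q f m)) + poly_op f (U_op q) m"
proof (rule normal_module_eqI[of "\<lambda>m. W_op q f (V_op m)"])
  show "linear_map (\<lambda>m. W_op q f (V_op m))"
    by (rule linear_map_comp[OF linear_ops(3) linear_ops(2)])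
  show "linear_map (\<lambda>m. smul (inverse q) (V_op (W_op q f m)) + poly_op f (U_op q) m)"
    by (rule linear_map_add[OF linear_map_smul[OF linear_map_comp[OF linear_ops(2) linear_ops(3)]]
        linear_poly_op[OF linear_ops(1)]])
qed (simp add: ops_monomial_vec)

text \<open>
  For \<open>i = 0\<close> this is the definition of the operator for \<open>w\<close>. In the induction step the vector is
  \<open>v e\<close>, and \<open>w u v e\<close> is computed by moving \<open>v\<close> to the front, using the induction hypothesis for \<open>w u e\<close>, and moving \<open>v\<close>
  back. The extra terms \<open>q u f(u) e\<close> and \<open>v f(v) e\<close> fit because a polynomial in an operator commutes
  with that operator. The hypothesis on \<open>q\<close> enters through \<open>q (inverse q) = 1\<close>.
\<close>

lemma W_U_op:
  assumes "q \<noteq> 0"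
  shows "W_op q f (U_op q m) = smul q (U_op q (W_op q f m)) + poly_op f V_op m"
proof (rule normal_module_eqI[of "\<lambda>m. W_op q f (U_op q m)"])
  show "W_op q f (U_op q (monomial_vec i j k)) =
    smul q (U_op q (W_op q f (monomial_vec i j k))) + poly_op f V_op (monomial_vec i j k)" for i j k
  proof (induction i)
    case 0
    show ?case
      by (simp add: ops_monomial_vec)
  next
    case (Suc i)
    let ?e = "monomial_vec i j k :: 'a normal_module"
    have "W_op q f (U_op q (V_op ?e)) = smul q (W_op q f (V_op (U_op q ?e)))"
      by (simp add: U_V_op linear_op_simps)
    also have "\<dots> = V_op (W_op q f (U_op q ?e)) + smul q (U_op q (poly_op f (U_op q) ?e))"
      by (simp add: W_V_op smul.scale_right_distrib assms poly_op_commute linear_ops)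
    also have "\<dots> = smul q (V_op (U_op q (W_op q f ?e))) + V_op (poly_op f V_op ?e)
        + smul q (U_op q (poly_op f (U_op q) ?e))"
      by (simp only: Suc.IH linear_op_simps)
    also have "\<dots> = smul q (U_op q (W_op q f (V_op ?e))) + poly_op f V_op (V_op ?e)"
      by (simp add: W_V_op U_V_op smul.scale_right_distrib linear_op_simps assms poly_op_commute
          linear_ops)
    finally show ?case
      by (simp add: ops_monomial_vec)
  qed
next
  show "linear_map (\<lambda>m. W_op q f (U_op q m))"
    by (rule linear_map_comp[OF linear_ops(3) linear_ops(1)])
  show "linear_map (\<lambda>m. smul q (U_op q (W_op q f m)) + poly_op f V_op m)"
    by (rule linear_map_add[OF linear_map_smul[OF linear_map_comp[OF linear_ops(1) linear_ops(3)]]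
        linear_poly_op[OF linear_ops(2)]])
qed

section \<open>The relations act as zero\<close>

text \<open>
  The elements annihilating the module form a two-sided ideal, and it contains the
  relations by the three commutation rules for the operators.
\<close>

lemma act_ideal:
  assumes "q \<noteq> 0" and "a \<in> Bq_ideal q f"
  shows "act (gen_op q f) a m = 0"
proof -
  let ?F = "ring_of_type_algebra :: 'a free_alg ring"
  let ?I = "{a. \<forall>m. act (gen_op q f) a m = 0}"
  interpret F: ring ?F
    by (rule ring_of_type_algebra_ring)
  note act = act_mult[of "gen_op q f", OF linear_gen_op]
    linear_map_simps[OF linear_act_left] act_poly_eval[of "gen_op q f", OF linear_gen_op]
    linear_map_simps[OF linear_act_right[of "gen_op q f", OF linear_gen_op]]
  have neg: "\<ominus>\<^bsub>?F\<^esub> x = - x" for x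
    by (rule F.minus_equality) (simp_all add: ring_of_type_algebra_def)
  have "ideal ?I ?F"
  proof (rule idealI[OF ring_of_type_algebra_ring])
    show "subgroup ?I (add_monoid ?F)"
    proof (rule F.add.subgroupI)
      show "?I \<noteq> {}"
        using act(4) by blast
      show "\<ominus>\<^bsub>?F\<^esub> a \<in> ?I" if "a \<in> ?I" for a
        using that unfolding neg by (simp add: smul_pair.linear_neg[OF linear_act_left])
    qed (auto simp: ring_of_type_algebra_def act)
  qed (auto simp: ring_of_type_algebra_def act)
  moreover have "Bq_relations q f \<subseteq> ?I"
    by (auto simp: Bq_relations_def Let_def act U_V_op W_V_op W_U_op assms(1))
  ultimately have "Bq_ideal q f \<subseteq> ?I"
    unfolding Bq_ideal_def by (rule F.genideal_minimal)
  then show ?thesis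
    using assms(2) by blast
qed

section \<open>Normal monomials span\<close>

definition normal_monomial :: "nat \<Rightarrow> nat \<Rightarrow> nat \<Rightarrow> 'k::field free_alg" where
  "normal_monomial i j k = free_gen V ^ i * free_gen U ^ j * free_gen W ^ k"

definition realize :: "'k::field normal_module \<Rightarrow> 'k free_alg" where
  "realize = lin_ext (\<lambda>(i, j, k). normal_monomial i j k)"

lemma linear_realize: "linear_map realize"
  unfolding realize_def by (rule linear_lin_ext)

lemmas realize_simps = linear_map_simps[OF linear_realize]

lemma realize_monomial_vec [simp]: "realize (monomial_vec i j k) = normal_monomial i j k"
  by (simp add: realize_def)

text \<open>
  Calculations in the quotient are carried out in the free algebra, with equality of
  classes as the congruence.
\<close>

lemma Bq_class_eq_iff: "Bq_class q f a = Bq_class q f b \<longleftrightarrow> a - b \<in> Bq_ideal q f"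
proof -
  let ?F = "ring_of_type_algebra :: 'a free_alg ring"
  interpret F: ring ?F
    by (rule ring_of_type_algebra_ring)
  have "\<ominus>\<^bsub>?F\<^esub> b = - b"
    by (rule F.minus_equality) (simp_all add: ring_of_type_algebra_def)
  then have "a \<ominus>\<^bsub>?F\<^esub> b = a - b"
    by (simp add: a_minus_def) (simp add: ring_of_type_algebra_def)
  with F.quotient_eq_iff_same_a_r_cos[OF Bq_ideal_ideal, of a b q f] show ?thesis
    by (simp add: Bq_class_def ring_of_type_algebra_def)
qed

lemma Bq_class_hom_simps:
  fixes q :: "'a::field"
  shows
  "Bq_class q f (a + b) = Bq_class q f a \<oplus>\<^bsub>ring_of_type_algebra Quot Bq_ideal q f\<^esub> Bq_class q f b"
  "Bq_class q f (a * b) = Bq_class q f a \<otimes>\<^bsub>ring_of_type_algebra Quot Bq_ideal q f\<^esub> Bq_class q f b"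
  "Bq_class q f 1 = \<one>\<^bsub>ring_of_type_algebra Quot Bq_ideal q f\<^esub>"
  "Bq_class q f a \<in> carrier (ring_of_type_algebra Quot Bq_ideal q f)"
proof -
  have F: "carrier (ring_of_type_algebra :: 'a free_alg ring) = UNIV"
    "add (ring_of_type_algebra :: 'a free_alg ring) = (+)"
    "monoid.mult (ring_of_type_algebra :: 'a free_alg ring) = (*)"
    "one (ring_of_type_algebra :: 'a free_alg ring) = 1"
    by (simp_all add: ring_of_type_algebra_def)
  note hom = Bq_class_hom[of q f]
  show "Bq_class q f (a + b) =
      Bq_class q f a \<oplus>\<^bsub>ring_of_type_algebra Quot Bq_ideal q f\<^esub> Bq_class q f b"
    using ring_hom_add[OF hom, of a b] unfolding F by simp
  show "Bq_class q f (a * b) =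
      Bq_class q f a \<otimes>\<^bsub>ring_of_type_algebra Quot Bq_ideal q f\<^esub> Bq_class q f b"
    using ring_hom_mult[OF hom, of a b] unfolding F by simp
  show "Bq_class q f 1 = \<one>\<^bsub>ring_of_type_algebra Quot Bq_ideal q f\<^esub>"
    using ring_hom_one[OF hom] unfolding F .
  show "Bq_class q f a \<in> carrier (ring_of_type_algebra Quot Bq_ideal q f)"
    using ring_hom_closed[OF hom, of a] unfolding F by simp
qed

lemma Bq_class_add_cong:
  assumes "Bq_class q f a = Bq_class q f a'" "Bq_class q f b = Bq_class q f b'"
  shows "Bq_class q f (a + b) = Bq_class q f (a' + b')"
  by (simp only: Bq_class_hom_simps assms)

lemma Bq_class_mult_cong:
  assumes "Bq_class q f a = Bq_class q f a'" "Bq_class q f b = Bq_class q f b'"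
  shows "Bq_class q f (a * b) = Bq_class q f (a' * b')"
  by (simp only: Bq_class_hom_simps assms)

lemma Bq_class_smul_cong:
  assumes "Bq_class q f a = Bq_class q f b"
  shows "Bq_class q f (smul c a) = Bq_class q f (smul c b)"
  unfolding smul_eq_scalar_mult by (rule Bq_class_mult_cong[OF refl assms])

lemma Bq_class_sum_cong:
  assumes "\<And>i. i \<in> I \<Longrightarrow> Bq_class q f (a i) = Bq_class q f (b i)"
  shows "Bq_class q f (\<Sum>i\<in>I. a i) = Bq_class q f (\<Sum>i\<in>I. b i)"
  using assms
proof (induction I rule: infinite_finite_induct)
  case (insert x I)
  have "Bq_class q f (a x + (\<Sum>i\<in>I. a i)) = Bq_class q f (b x + (\<Sum>i\<in>I. b i))"
    by (rule Bq_class_add_cong) (use insert in auto)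
  with insert.hyps show ?case
    by simp
qed simp_all

lemma Bq_class_relations:
  "Bq_class q f (free_gen U * free_gen V) = Bq_class q f (smul q (free_gen V * free_gen U))"
  "Bq_class q f (free_gen W * free_gen U) =
    Bq_class q f (smul q (free_gen U * free_gen W) + poly_eval f (free_gen V))"
  "Bq_class q f (free_gen W * free_gen V) =
    Bq_class q f (smul (inverse q) (free_gen V * free_gen W) + poly_eval f (free_gen U))"
proof -
  have "Bq_relations q f \<subseteq> Bq_ideal q f"
    unfolding Bq_ideal_def
    by (rule ring.genideal_self[OF ring_of_type_algebra_ring])
      (simp add: ring_of_type_algebra_def)
  then show
    "Bq_class q f (free_gen U * free_gen V) = Bq_class q f (smul q (free_gen V * free_gen U))"
    "Bq_class q f (free_gen W * free_gen U) =
      Bq_class q f (smul q (free_gen U * free_gen W) + poly_eval f (free_gen V))"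
    "Bq_class q f (free_gen W * free_gen V) =
      Bq_class q f (smul (inverse q) (free_gen V * free_gen W) + poly_eval f (free_gen U))"
    by (simp_all add: Bq_class_eq_iff Bq_relations_def Let_def smul_eq_scalar_mult mult.assoc)
qed

text \<open>
  The intertwining property at one generator and one vector. Keeping the vector explicit allows the
  induction over basis vectors.
\<close>

definition realizes_gen :: "'k::field \<Rightarrow> 'k poly \<Rightarrow> generator \<Rightarrow> 'k normal_module \<Rightarrow> bool" where
  "realizes_gen q f x m \<longleftrightarrow>
    Bq_class q f (realize (gen_op q f x m)) = Bq_class q f (free_gen x * realize m)"

lemma realizes_gen_linear_ext:
  assumes "\<And>i j k. realizes_gen q f x (monomial_vec i j k)"
  shows "realizes_gen q f x m"
proof (induction m rule: finsupp_induct)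
  case 1
  show ?case
    by (simp add: realizes_gen_def gen_op_simps realize_simps)
next
  case (2 a b)
  then show ?case
    by (simp add: realizes_gen_def gen_op_simps realize_simps distrib_left
        Bq_class_hom_simps(1))
next
  case (3 c y)
  obtain i j k where y: "y = (i, j, k)"
    by (cases y)
  show ?case
    using Bq_class_smul_cong[OF assms[of i j k, unfolded realizes_gen_def], of c]
    by (simp only: realizes_gen_def gen_op_simps realize_simps mult_smul_right y)
qed

lemma realizes_poly_op:
  assumes "\<And>m. realizes_gen q f x m"
  shows "Bq_class q f (realize (poly_op g (gen_op q f x) m)) =
    Bq_class q f (poly_eval g (free_gen x) * realize m)"
proof -
  have pow: "Bq_class q f (realize ((gen_op q f x ^^ n) m)) =
      Bq_class q f (free_gen x ^ n * realize m)" for n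
  proof (induction n)
    case 0
    show ?case
      by simp
  next
    case (Suc n)
    have "Bq_class q f (realize ((gen_op q f x ^^ Suc n) m)) =
        Bq_class q f (free_gen x * realize ((gen_op q f x ^^ n) m))"
      using assms by (simp add: realizes_gen_def)
    also have "\<dots> = Bq_class q f (free_gen x * (free_gen x ^ n * realize m))"
      by (rule Bq_class_mult_cong[OF refl Suc.IH])
    finally show ?case
      by (simp add: mult.assoc)
  qed
  have "Bq_class q f (realize (poly_op g (gen_op q f x) m)) =
      Bq_class q f (\<Sum>i\<le>degree g. smul (coeff g i) (realize ((gen_op q f x ^^ i) m)))"
    by (simp only: poly_op_def realize_simps)
  also have "\<dots> = Bq_class q f (\<Sum>i\<le>degree g. smul (coeff g i) (free_gen x ^ i * realize m))"
    by (intro Bq_class_sum_cong Bq_class_smul_cong pow)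
  also have "\<dots> = Bq_class q f (poly_eval g (free_gen x) * realize m)"
    by (simp add: poly_eval_def sum_distrib_right flip: smul_eq_scalar_mult)
  finally show ?thesis .
qed

lemma realizes_V: "realizes_gen q f V m"
  by (rule realizes_gen_linear_ext)
    (simp add: realizes_gen_def ops_monomial_vec normal_monomial_def mult.assoc)

text \<open>
  The relation \<open>u v = q v u\<close> holds for the operators as well as in the quotient, so that one factor
  \<open>v\<close> at a time can be split off from the monomial.
\<close>

lemma realizes_U: "realizes_gen q f U m"
proof (rule realizes_gen_linear_ext)
  show "realizes_gen q f U (monomial_vec i j k)" for i j k
  proof (induction i)
    case 0
    show ?case
      by (simp add: realizes_gen_def ops_monomial_vec normal_monomial_def mult.assoc)
  next
    case (Suc i)
    let ?e = "monomial_vec i j k :: 'a normal_module"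
    have "realize (U_op q (V_op ?e)) = smul q (realize (V_op (U_op q ?e)))"
      by (simp add: U_V_op realize_simps)
    also have "Bq_class q f \<dots> = Bq_class q f (smul q (free_gen V * realize (U_op q ?e)))"
      using realizes_V[of q f "U_op q ?e"]
      by (intro Bq_class_smul_cong) (simp add: realizes_gen_def)
    also have "\<dots> = Bq_class q f (smul q (free_gen V * (free_gen U * realize ?e)))"
      using Suc by (intro Bq_class_smul_cong Bq_class_mult_cong) (simp_all add: realizes_gen_def)
    also have "\<dots> = Bq_class q f (smul q (free_gen V * free_gen U) * realize ?e)"
      by (simp add: mult.assoc)
    also have "\<dots> = Bq_class q f (free_gen U * free_gen V * realize ?e)"
      by (intro Bq_class_mult_cong) (simp_all add: Bq_class_relations)
    finally show ?case
      by (simp add: realizes_gen_def ops_monomial_vec normal_monomial_def mult.assoc)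
  qed
qed

text \<open>
  The induction follows the recursion of \<^const>\<open>W_monomial\<close>: each recursive equation is the
  image of one of the relations, applied to the shorter monomial \<open>e\<close>.
\<close>

lemma realizes_W: "realizes_gen q f W m"
proof (rule realizes_gen_linear_ext)
  have poly: "Bq_class q f (realize (poly_op g V_op m)) =
      Bq_class q f (poly_eval g (free_gen V) * realize m)"
    "Bq_class q f (realize (poly_op g (U_op q) m)) =
      Bq_class q f (poly_eval g (free_gen U) * realize m)" for g m
    using realizes_poly_op[of q f V g m, OF realizes_V]
      realizes_poly_op[of q f U g m, OF realizes_U] by simp_all
  have U_gen: "Bq_class q f (realize (U_op q m)) = Bq_class q f (free_gen U * realize m)"
    and V_gen: "Bq_class q f (realize (V_op m)) = Bq_class q f (free_gen V * realize m)" for m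
    using realizes_U[of q f m] realizes_V[of q f m] by (simp_all add: realizes_gen_def)
  show "realizes_gen q f W (monomial_vec i j k)" for i j k
  proof (induction i)
    case 0
    show ?case
    proof (induction j)
      case 0
      show ?case
        by (simp add: realizes_gen_def ops_monomial_vec normal_monomial_def)
    next
      case (Suc j)
      let ?e = "monomial_vec 0 j k :: 'a normal_module"
      have "Bq_class q f (realize (W_monomial q f 0 (Suc j) k)) =
          Bq_class q f (smul q (realize (U_op q (W_op q f ?e))) + realize (poly_op f V_op ?e))"
        by (simp add: realize_simps ops_monomial_vec)
      also have "\<dots> = Bq_class q f (smul q (free_gen U * realize (W_op q f ?e))
          + poly_eval f (free_gen V) * realize ?e)"
        by (intro Bq_class_add_cong Bq_class_smul_cong U_gen poly)
      also have "\<dots> = Bq_class q f (smul q (free_gen U * (free_gen W * realize ?e))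
          + poly_eval f (free_gen V) * realize ?e)"
        using Suc by (intro Bq_class_add_cong Bq_class_smul_cong Bq_class_mult_cong)
          (simp_all add: realizes_gen_def)
      also have "\<dots> = Bq_class q f
          ((smul q (free_gen U * free_gen W) + poly_eval f (free_gen V)) * realize ?e)"
        by (simp add: mult.assoc distrib_right)
      also have "\<dots> = Bq_class q f (free_gen W * free_gen U * realize ?e)"
        by (intro Bq_class_mult_cong) (simp_all add: Bq_class_relations)
      finally show ?case
        by (simp add: realizes_gen_def ops_monomial_vec normal_monomial_def mult.assoc
            del: W_monomial.simps)
    qed
  next
    case (Suc i)
    let ?e = "monomial_vec i j k :: 'a normal_module"
    have "Bq_class q f (realize (W_monomial q f (Suc i) j k)) =
        Bq_class q f (smul (inverse q) (realize (V_op (W_op q f ?e)))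
          + realize (poly_op f (U_op q) ?e))"
      by (simp add: realize_simps ops_monomial_vec)
    also have "\<dots> = Bq_class q f (smul (inverse q) (free_gen V * realize (W_op q f ?e))
        + poly_eval f (free_gen U) * realize ?e)"
      by (intro Bq_class_add_cong Bq_class_smul_cong V_gen poly)
    also have "\<dots> = Bq_class q f (smul (inverse q) (free_gen V * (free_gen W * realize ?e))
        + poly_eval f (free_gen U) * realize ?e)"
      using Suc by (intro Bq_class_add_cong Bq_class_smul_cong Bq_class_mult_cong)
        (simp_all add: realizes_gen_def)
    also have "\<dots> = Bq_class q f
        ((smul (inverse q) (free_gen V * free_gen W) + poly_eval f (free_gen U)) * realize ?e)"
      by (simp add: mult.assoc distrib_right)
    also have "\<dots> = Bq_class q f (free_gen W * free_gen V * realize ?e)"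
      by (intro Bq_class_mult_cong) (simp_all add: Bq_class_relations)
    finally show ?case
      by (simp add: realizes_gen_def ops_monomial_vec normal_monomial_def mult.assoc
          del: W_monomial.simps)
  qed
qed

lemma realizes_gen: "realizes_gen q f x m"
  by (cases x) (auto intro: realizes_U realizes_V realizes_W)

section \<open>The normal form\<close>

definition normal_form :: "'k::field \<Rightarrow> 'k poly \<Rightarrow> 'k free_alg \<Rightarrow> 'k normal_module" where
  "normal_form q f a = act (gen_op q f) a (monomial_vec 0 0 0)"

lemma linear_normal_form: "linear_map (normal_form q f)"
  unfolding normal_form_def[abs_def] by (rule linear_act_left)

lemmas normal_form_simps = linear_map_simps[OF linear_normal_form]

text \<open>
  Linear independence rests on this: the ideal annihilates the module, so the normal form can be
  read off from the class.
\<close>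

lemma normal_form_cong:
  assumes "q \<noteq> 0" "Bq_class q f a = Bq_class q f b"
  shows "normal_form q f a = normal_form q f b"
proof -
  have "normal_form q f (a - b) = 0"
    using assms by (simp add: normal_form_def act_ideal Bq_class_eq_iff)
  then show ?thesis
    by (simp add: normal_form_simps)
qed

text \<open>
  By linearity it is enough to treat words, and there the intertwining property strips off one letter
  at a time until the empty word is left, whose normal form \<open>e\<^bsub>000\<^esub>\<close> is realized by \<open>1\<close>.
\<close>

lemma Bq_class_realize_normal_form: "Bq_class q f (realize (normal_form q f a)) = Bq_class q f a"
proof (induction a rule: finsupp_induct)
  case 1
  show ?case
    by (simp add: normal_form_simps realize_simps)
next
  case (2 a b)
  then show ?case
    by (simp add: normal_form_simps realize_simps Bq_class_hom_simps(1))
next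
  case (3 c x)
  have "Bq_class q f (realize (foldr (gen_op q f) xs (monomial_vec 0 0 0))) =
      Bq_class q f (Poly_Mapping.single (Word xs) 1)" for xs
  proof (induction xs)
    case Nil
    show ?case
      by (simp add: normal_monomial_def flip: zero_word_def)
  next
    case (Cons x xs)
    have "Bq_class q f (realize (foldr (gen_op q f) (x # xs) (monomial_vec 0 0 0))) =
        Bq_class q f (free_gen x * realize (foldr (gen_op q f) xs (monomial_vec 0 0 0)))"
      using realizes_gen[of q f x] by (simp add: realizes_gen_def)
    also have "\<dots> = Bq_class q f (free_gen x * Poly_Mapping.single (Word xs) 1)"
      by (intro Bq_class_mult_cong Cons.IH refl)
    finally show ?case
      by (simp add: free_gen_def mult_single plus_word_def)
  qed
  then have "Bq_class q f (smul c (realize (foldr (gen_op q f) (letters x) (monomial_vec 0 0 0)))) =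
      Bq_class q f (smul c (Poly_Mapping.single x 1))"
    by (intro Bq_class_smul_cong) (metis word.collapse)
  then show ?case
    by (simp add: normal_form_def act_def realize_simps)
qed

text \<open>
  Applying \<open>w\<^sup>k\<close>, then \<open>u\<^sup>j\<close>, then \<open>v\<^sup>i\<close> to \<open>e\<^bsub>000\<^esub>\<close> produces \<open>e\<^bsub>ijk\<^esub>\<close> with no extra term or factor, because
  in this order no letter has to be moved past another.
\<close>

lemma normal_form_realize: "normal_form q f (realize m) = m"
proof (rule normal_module_eqI[of "\<lambda>m. normal_form q f (realize m)" "\<lambda>m. m"])
  fix i j k
  have W: "(W_op q f ^^ k) (monomial_vec 0 0 0) = monomial_vec 0 0 k"
    by (induction k) (simp_all add: ops_monomial_vec)
  have U: "(U_op q ^^ j) (monomial_vec 0 0 k) = monomial_vec 0 j k"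
    by (induction j) (simp_all add: ops_monomial_vec)
  have V: "(V_op ^^ i) (monomial_vec 0 j k) = (monomial_vec i j k :: 'a normal_module)"
    by (induction i) (simp_all add: ops_monomial_vec)
  show "normal_form q f (realize (monomial_vec i j k)) = monomial_vec i j k"
    by (simp add: normal_form_def normal_monomial_def act_mult act_power linear_gen_op W U V)
qed (intro linear_map_comp[OF linear_normal_form linear_realize] linear_map_ident)+

section \<open>The basis theorem\<close>

lemma Bq_sel:
  "carrier (Bq q f) = carrier (ring_of_type_algebra Quot Bq_ideal q f)"
  "add (Bq q f) = add (ring_of_type_algebra Quot Bq_ideal q f)"
  "zero (Bq q f) = zero (ring_of_type_algebra Quot Bq_ideal q f)"
  "monoid.mult (Bq q f) = monoid.mult (ring_of_type_algebra Quot Bq_ideal q f)"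
  "one (Bq q f) = one (ring_of_type_algebra Quot Bq_ideal q f)"
  "module.smult (Bq q f) = (\<lambda>c x. Bq_class q f (scalar c)
    \<otimes>\<^bsub>ring_of_type_algebra Quot Bq_ideal q f\<^esub> x)"
  by (simp_all add: Bq_def Let_def ring.extend_def module.fields_def)

lemma Bq_class_ops:
  "Bq_class q f a \<in> carrier (Bq q f)"
  "Bq_class q f a \<oplus>\<^bsub>Bq q f\<^esub> Bq_class q f b = Bq_class q f (a + b)"
  "Bq_class q f a \<otimes>\<^bsub>Bq q f\<^esub> Bq_class q f b = Bq_class q f (a * b)"
  "c \<odot>\<^bsub>Bq q f\<^esub> Bq_class q f a = Bq_class q f (smul c a)"
  "\<one>\<^bsub>Bq q f\<^esub> = Bq_class q f 1"
  by (simp_all add: Bq_sel Bq_class_hom_simps smul_eq_scalar_mult)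

lemma Bq_zero: "\<zero>\<^bsub>Bq q f\<^esub> = Bq_class q f 0"
proof -
  interpret Q: ring "ring_of_type_algebra Quot Bq_ideal q f"
    by (rule ideal.quotient_is_ring[OF Bq_ideal_ideal])
  show ?thesis
    using Bq_class_hom_simps(1)[of q f 0 0] Bq_class_hom_simps(4)[of q f 0]
    by (simp add: Bq_sel)
qed

lemma Bq_carrier: "carrier (Bq q f) = range (Bq_class q f)"
  by (auto simp: Bq_sel FactRing_def A_RCOSETS_def' Bq_class_def ring_of_type_algebra_def)

lemma Bq_class_power: "Bq_class q f a [^]\<^bsub>Bq q f\<^esub> (n::nat) = Bq_class q f (a ^ n)"
  by (induction n) (simp_all add: Bq_class_ops nat_pow_def power_Suc2 del: power_Suc)

lemma Bq_monomial_eq: "Bq_monomial q f (i, j, k) = Bq_class q f (normal_monomial i j k)"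
  by (simp add: Bq_monomial_def Bq_gen_def Bq_class_power Bq_class_ops normal_monomial_def)

lemma Bq_monomial_realize: "Bq_monomial q f x = Bq_class q f (realize (Poly_Mapping.single x 1))"
  by (cases x) (simp add: Bq_monomial_eq)

lemma inj_Bq_monomial:
  assumes "q \<noteq> 0"
  shows "inj (Bq_monomial q f)"
proof (rule injI)
  fix x y
  assume "Bq_monomial q f x = Bq_monomial q f y"
  then have "Poly_Mapping.single x 1 = (Poly_Mapping.single y 1 :: 'a normal_module)"
    using normal_form_cong[OF assms] by (metis Bq_monomial_realize normal_form_realize)
  then have "Poly_Mapping.keys (Poly_Mapping.single x (1::'a)) =
      Poly_Mapping.keys (Poly_Mapping.single y (1::'a))"
    by simp
  then show "x = y"
    by simp
qed

text \<open>
  A linear combination in a vector space is indexed by vectors, not by exponents; injectivity of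
  \<^const>\<open>Bq_monomial\<close> is what allows passing to exponents.
\<close>

lemma lincomb_Bq_monomials:
  fixes c :: "nat \<times> nat \<times> nat \<Rightarrow> 'k::field"
  assumes "q \<noteq> 0" "finite S" and coeffs: "\<And>x. x \<in> S \<Longrightarrow> a (Bq_monomial q f x) = c x"
  shows "module.lincomb (Bq q f) a (Bq_monomial q f ` S) =
    Bq_class q f (realize (\<Sum>x\<in>S. Poly_Mapping.single x (c x)))"
proof -
  interpret B: vectorspace ring_of_type_algebra "Bq q f"
    by (rule Bq_vectorspace)
  have "finsum (Bq q f) (\<lambda>v. a v \<odot>\<^bsub>Bq q f\<^esub> v) (Bq_monomial q f ` S) =
      finsum (Bq q f) (\<lambda>x. a (Bq_monomial q f x) \<odot>\<^bsub>Bq q f\<^esub> Bq_monomial q f x) S"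
    by (rule B.add.finprod_reindex)
      (auto simp: Bq_monomial_realize Bq_class_ops
        intro: inj_on_subset[OF inj_Bq_monomial[OF assms(1)]])
  also have "\<dots> = Bq_class q f (realize (\<Sum>x\<in>S. Poly_Mapping.single x (c x)))"
    using assms(2) coeffs
  proof (induction S)
    case empty
    show ?case
      by (simp add: realize_simps Bq_zero)
  next
    case (insert x S)
    have "c x \<odot>\<^bsub>Bq q f\<^esub> Bq_monomial q f x = Bq_class q f (realize (Poly_Mapping.single x (c x)))"
      using realize_simps(2)[of "c x" "Poly_Mapping.single x 1"]
      by (simp add: Bq_monomial_realize Bq_class_ops)
    with insert show ?case
      by (subst B.finsum_insert)
        (auto simp: Bq_monomial_realize Bq_class_ops realize_simps)
  qed
  finally show ?thesis
    by (simp add: B.lincomb_def)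
qed

theorem proposition9p2:
  fixes q :: "'k :: {alg_closed_field, field_char_0}"
    and f :: "'k poly"
  assumes "q \<noteq> 0"
  shows "inj (Bq_monomial q f) \<and>
    vectorspace.basis ring_of_type_algebra (Bq q f) {Bq_monomial q f (i, j, k) | i j k. True}"
proof
  show inj: "inj (Bq_monomial q f)"
    by (rule inj_Bq_monomial[OF assms])
  interpret B: vectorspace ring_of_type_algebra "Bq q f"
    by (rule Bq_vectorspace)
  have set_eq: "{Bq_monomial q f (i, j, k) | i j k. True} = range (Bq_monomial q f)"
    by (auto simp: image_iff)
  have sub: "range (Bq_monomial q f) \<subseteq> carrier (Bq q f)"
    by (auto simp: Bq_monomial_realize Bq_class_ops)
  have "B.lin_indpt (range (Bq_monomial q f))"
  proof
    assume "B.lin_dep (range (Bq_monomial q f))"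
    then obtain A a v where A: "finite A" "A \<subseteq> range (Bq_monomial q f)"
      and zero: "B.lincomb a A = \<zero>\<^bsub>Bq q f\<^esub>"
      and v: "v \<in> A" "a v \<noteq> \<zero>\<^bsub>ring_of_type_algebra\<^esub>"
      unfolding B.lin_dep_def by blast
    from A obtain S where S: "finite S" "A = Bq_monomial q f ` S"
      by (meson finite_subset_image)
    \<comment> \<open>The vanishing combination, lifted to the module with basis the exponents.\<close>
    define m where "m = (\<Sum>x\<in>S. Poly_Mapping.single x (a (Bq_monomial q f x)))"
    have "Bq_class q f (realize m) = Bq_class q f 0"
      using zero lincomb_Bq_monomials[OF assms S(1), of a f] by (simp add: S(2) m_def Bq_zero)
    then have "normal_form q f (realize m) = normal_form q f 0"
      by (rule normal_form_cong[OF assms])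
    then have "m = 0"
      by (simp add: normal_form_realize normal_form_simps)
    moreover obtain x where x: "x \<in> S" "v = Bq_monomial q f x"
      using v(1) S(2) by blast
    moreover have "Poly_Mapping.lookup m x = a v"
      using S(1) x by (simp add: m_def lookup_sum lookup_single when_def)
    ultimately show False
      using v(2) by (simp add: ring_of_type_algebra_def)
  qed
  moreover have "B.gen_set (range (Bq_monomial q f))"
  proof
    show "B.span (range (Bq_monomial q f)) \<subseteq> carrier (Bq q f)"
      by (rule B.span_is_subset2[OF sub])
    show "carrier (Bq q f) \<subseteq> B.span (range (Bq_monomial q f))"
    proof
      fix y
      assume "y \<in> carrier (Bq q f)"
      then obtain b where b: "y = Bq_class q f b"
        by (auto simp: Bq_carrier)
      define m where "m = normal_form q f b"
      \<comment> \<open>The coefficients of the normal form, transported from exponents to monomials.\<close>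
      define a where "a = Poly_Mapping.lookup m \<circ> inv_into UNIV (Bq_monomial q f)"
      have "a (Bq_monomial q f x) = Poly_Mapping.lookup m x" for x
        by (simp add: a_def inv_f_f[OF inj])
      then have "B.lincomb a (Bq_monomial q f ` Poly_Mapping.keys m) = Bq_class q f (realize
          (\<Sum>x\<in>Poly_Mapping.keys m. Poly_Mapping.single x (Poly_Mapping.lookup m x)))"
        by (intro lincomb_Bq_monomials assms) auto
      also have "\<dots> = y"
        using decompose_finsupp[of m] by (simp add: b m_def Bq_class_realize_normal_form)
      finally have "y = B.lincomb a (Bq_monomial q f ` Poly_Mapping.keys m)" ..
      moreover have "a \<in> Bq_monomial q f ` Poly_Mapping.keys m \<rightarrow> carrier ring_of_type_algebra"
        by (simp add: ring_of_type_algebra_def)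
      ultimately show "y \<in> B.span (range (Bq_monomial q f))"
        unfolding B.span_def by (blast intro: finite_keys)
    qed
  qed
  ultimately show
    "vectorspace.basis ring_of_type_algebra (Bq q f) {Bq_monomial q f (i, j, k) | i j k. True}"
    unfolding set_eq B.basis_def using sub by blast
qed

end
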